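(* Let $\{G_i: i\in I\}$ be a family of metrizable topological groups indexed by a countable set $I$, let $\mathcal U$ be a non-principal ultrafilter on $I$, and let $G$ be the Bankston ultraproduct of the family $\{G_i\}$ with regard to $\mathcal U$. Then $G$ is spherically complete. As a consequence, if in addition all the groups $G_i$ are non-discrete, then $G$ is a non-metrizable Baire group with a local $\omega^\omega$-base.
   Context: Bankston ultraproduct: the quotient topological group of the box product $\square_{i\in I}G_i$ (the Cartesian product group with the box topology) by the closed normal subgroup $N=\{g: \{i\in I: g_i=e_i\}\in\mathcal U\}$. A topological group $G$ is spherically complete if there exists a base $\mathcal B$ of neighbourhoods of the identity with the following property: whenever $\{V_n\in\mathcal B: n\in\omega\}$ is a (non-strictly) decreasing sequence and $\{g_n\in G: n\in\omega\}$ is a sequence such that the sequence of sets $\{g_nV_n: n\in\omega\}$ is decreasing by inclusion, the intersection $\bigcap_{n}g_nV_n$ is non-empty. A topological space is Baire if the union of every countable collection of closed sets with empty interior has empty interior. The set $\omega^\omega$ of all functions $\omega\to\omega$ carries the pointwise partial order. A topological group $G$ admits a local $\omega^\omega$-base if there is a family $\{U_\alpha:\alpha\in\omega^\omega\}$ of neighbourhoods of the identity such that $\alpha\le\beta$ implies $U_\beta\subseteq U_\alpha$ and every neighbourhood of the identity contains some $U_\alpha$. *)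

theory Defs
  imports "HOL-Analysis.Analysis" "HOL-Algebra.Product_Groups"
begin

subsection \<open>Topological groups\<close>

locale topological_group = group G for G (structure) +
  fixes T :: "'a topology"
  assumes topspace_eq_carrier: "topspace T = carrier G"
    and continuous_map_mult: "continuous_map (prod_topology T T) T (\<lambda>(x, y). x \<otimes> y)"
    and continuous_map_inv: "continuous_map T T (\<lambda>x. inv x)"

text \<open>Neighbourhoods are not required to be open.\<close>

definition neighbourhood_of :: "'a topology \<Rightarrow> 'a \<Rightarrow> 'a set \<Rightarrow> bool" where
  "neighbourhood_of X x V \<longleftrightarrow>
     V \<subseteq> topspace X \<and> (\<exists>W. openin X W \<and> x \<in> W \<and> W \<subseteq> V)"

definition neighbourhood_base :: "'a topology \<Rightarrow> 'a \<Rightarrow> 'a set set \<Rightarrow> bool" where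
  "neighbourhood_base X x B \<longleftrightarrow>
     (\<forall>V\<in>B. neighbourhood_of X x V) \<and> (\<forall>W. neighbourhood_of X x W \<longrightarrow> (\<exists>V\<in>B. V \<subseteq> W))"

definition spherically_complete :: "('a, 'b) monoid_scheme \<Rightarrow> 'a topology \<Rightarrow> bool" where
  "spherically_complete G T \<longleftrightarrow>
     topological_group G T \<and>
     (\<exists>B. neighbourhood_base T \<one>\<^bsub>G\<^esub> B \<and>
        (\<forall>(V :: nat \<Rightarrow> 'a set) (g :: nat \<Rightarrow> 'a).
           (\<forall>n. V n \<in> B) \<and> decseq V \<and>
           (\<forall>n. g n \<in> carrier G) \<and> decseq (\<lambda>n. g n <#\<^bsub>G\<^esub> V n)
           \<longrightarrow> (\<Inter>n. g n <#\<^bsub>G\<^esub> V n) \<noteq> {}))"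

text \<open>The order on \<^typ>\<open>nat \<Rightarrow> nat\<close> is the pointwise one.\<close>

definition has_local_omega_omega_base :: "('a, 'b) monoid_scheme \<Rightarrow> 'a topology \<Rightarrow> bool" where
  "has_local_omega_omega_base G T \<longleftrightarrow>
     topological_group G T \<and>
     (\<exists>U :: (nat \<Rightarrow> nat) \<Rightarrow> 'a set.
        (\<forall>\<alpha>. neighbourhood_of T \<one>\<^bsub>G\<^esub> (U \<alpha>)) \<and>
        (\<forall>\<alpha> \<beta>. \<alpha> \<le> \<beta> \<longrightarrow> U \<beta> \<subseteq> U \<alpha>) \<and>
        (\<forall>W. neighbourhood_of T \<one>\<^bsub>G\<^esub> W \<longrightarrow> (\<exists>\<alpha>. U \<alpha> \<subseteq> W)))"

definition Baire_space :: "'a topology \<Rightarrow> bool" where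
  "Baire_space X \<longleftrightarrow>
     (\<forall>\<C>. countable \<C> \<and> (\<forall>C\<in>\<C>. closedin X C \<and> X interior_of C = {})
        \<longrightarrow> X interior_of \<Union>\<C> = {})"


subsection \<open>Ultrafilters on a set\<close>

definition ultrafilter_on :: "'i set \<Rightarrow> 'i set set \<Rightarrow> bool" where
  "ultrafilter_on I \<U> \<longleftrightarrow>
     \<U> \<subseteq> Pow I \<and> I \<in> \<U> \<and> {} \<notin> \<U> \<and>
     (\<forall>A\<in>\<U>. \<forall>B\<in>\<U>. A \<inter> B \<in> \<U>) \<and>
     (\<forall>A\<in>\<U>. \<forall>B. A \<subseteq> B \<and> B \<subseteq> I \<longrightarrow> B \<in> \<U>) \<and>
     (\<forall>A. A \<subseteq> I \<longrightarrow> A \<in> \<U> \<or> I - A \<in> \<U>)"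

definition principal_ultrafilter_on :: "'i set \<Rightarrow> 'i set set \<Rightarrow> bool" where
  "principal_ultrafilter_on I \<U> \<longleftrightarrow> (\<exists>i\<in>I. \<U> = {A. A \<subseteq> I \<and> i \<in> A})"


subsection \<open>Box products and quotients\<close>

definition box_topology :: "'i set \<Rightarrow> ('i \<Rightarrow> 'a topology) \<Rightarrow> ('i \<Rightarrow> 'a) topology" where
  "box_topology I T =
     topology_generated_by {\<Pi>\<^sub>E i\<in>I. V i | V. \<forall>i\<in>I. openin (T i) (V i)}"

lemma topspace_box_topology: "topspace (box_topology I T) = (\<Pi>\<^sub>E i\<in>I. topspace (T i))"
proof -
  have "(\<Pi>\<^sub>E i\<in>I. V i) \<subseteq> (\<Pi>\<^sub>E i\<in>I. topspace (T i))" if "\<forall>i\<in>I. openin (T i) (V i)" for V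
    using that by (intro PiE_mono) (auto dest: openin_subset)
  moreover have "(\<Pi>\<^sub>E i\<in>I. topspace (T i)) \<in> {\<Pi>\<^sub>E i\<in>I. V i | V. \<forall>i\<in>I. openin (T i) (V i)}"
    by blast
  ultimately show ?thesis
    unfolding box_topology_def topology_generated_by_topspace by blast
qed

definition quotient_topology :: "'a topology \<Rightarrow> ('a \<Rightarrow> 'b) \<Rightarrow> 'b topology" where
  "quotient_topology X f =
     topology (\<lambda>W. W \<subseteq> f ` topspace X \<and> openin X {x \<in> topspace X. f x \<in> W})"

lemma openin_quotient_topology:
  "openin (quotient_topology X f) W \<longleftrightarrow>
     W \<subseteq> f ` topspace X \<and> openin X {x \<in> topspace X. f x \<in> W}"
proof -
  have "istopology (\<lambda>W. W \<subseteq> f ` topspace X \<and> openin X {x \<in> topspace X. f x \<in> W})"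
    unfolding istopology_def
  proof (intro conjI allI impI; (elim conjE)?)
    fix S T assume "openin X {x \<in> topspace X. f x \<in> S}" "openin X {x \<in> topspace X. f x \<in> T}"
    then have "openin X ({x \<in> topspace X. f x \<in> S} \<inter> {x \<in> topspace X. f x \<in> T})"
      by (rule openin_Int)
    then show "openin X {x \<in> topspace X. f x \<in> S \<inter> T}"
      by (rule back_subst) auto
  next
    fix K assume "\<forall>S\<in>K. S \<subseteq> f ` topspace X \<and> openin X {x \<in> topspace X. f x \<in> S}"
    then have "openin X (\<Union>S\<in>K. {x \<in> topspace X. f x \<in> S})" by blast
    then show "openin X {x \<in> topspace X. f x \<in> \<Union>K}"
      by (rule back_subst) auto
  qed auto
  then show ?thesis
    by (simp add: quotient_topology_def topology_inverse')
qed

lemma topspace_quotient_topology: "topspace (quotient_topology X f) = f ` topspace X"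
proof -
  have "{x \<in> topspace X. f x \<in> f ` topspace X} = topspace X" by auto
  then have "openin (quotient_topology X f) (f ` topspace X)"
    by (simp add: openin_quotient_topology)
  moreover have "W \<subseteq> f ` topspace X" if "openin (quotient_topology X f) W" for W
    using that by (simp add: openin_quotient_topology)
  ultimately show ?thesis
    by (metis openin_subset openin_topspace subset_antisym)
qed

lemma quotient_map_quotient_topology: "quotient_map X (quotient_topology X f) f"
  by (simp add: quotient_map_def topspace_quotient_topology openin_quotient_topology)


subsection \<open>Bankston ultraproducts\<close>

definition ultraproduct_kernel ::
    "'i set \<Rightarrow> ('i \<Rightarrow> ('a, 'b) monoid_scheme) \<Rightarrow> 'i set set \<Rightarrow> ('i \<Rightarrow> 'a) set" where
  "ultraproduct_kernel I G \<U> =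
     {g \<in> carrier (product_group I G). {i \<in> I. g i = \<one>\<^bsub>G i\<^esub>} \<in> \<U>}"

definition Bankston_group ::
    "'i set \<Rightarrow> ('i \<Rightarrow> ('a, 'b) monoid_scheme) \<Rightarrow> 'i set set \<Rightarrow> ('i \<Rightarrow> 'a) set monoid" where
  "Bankston_group I G \<U> = product_group I G Mod ultraproduct_kernel I G \<U>"

definition Bankston_topology ::
    "'i set \<Rightarrow> ('i \<Rightarrow> ('a, 'b) monoid_scheme) \<Rightarrow> ('i \<Rightarrow> 'a topology) \<Rightarrow> 'i set set
      \<Rightarrow> ('i \<Rightarrow> 'a) set topology" where
  "Bankston_topology I G T \<U> =
     quotient_topology (box_topology I T)
       (\<lambda>g. ultraproduct_kernel I G \<U> #>\<^bsub>product_group I G\<^esub> g)"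

end

theory Submission
  imports Defs
begin

text \<open>
  The sets \<open>\<pi> (\<Prod> V\<^sub>i)\<close>, with \<open>V\<^sub>i\<close> an open neighbourhood of the identity of \<open>G\<^sub>i\<close>, form a base at the identity
  of the ultraproduct, and their translates are again internal, i.e. images of boxes. Membership in an
  internal set is decided coordinatewise modulo \<open>\<U>\<close>. Since \<open>I\<close> is countable and \<open>\<U>\<close> is non-principal,
  all tails of an enumeration of \<open>I\<close> lie in \<open>\<U>\<close>, so a diagonal choice produces a point in any decreasing
  sequence of nonempty internal sets (countable saturation); this is spherical completeness, and it
  implies Baire by the usual nested sequence argument. The same diagonalisation shows that a countable
  intersection of neighbourhoods of the identity contains a basic one, so that a metrizable
  ultraproduct would be discrete.
\<close>

(* Multiset's subset_mset would make the notation for left cosets ambiguous. *)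
no_notation subset_mset (infix \<open><#\<close> 50)

text \<open>Balls of radius 1/(n+1) around \<open>x\<close> serve. The sequence is asked to be
  decreasing because this is what later makes the family indexed by functions from nat to nat
  antitone.\<close>

lemma metrizable_decseq_base:
  assumes "metrizable_space X" "x \<in> topspace X"
  obtains W :: "nat \<Rightarrow> 'a set" where
    "\<And>n. openin X (W n)" "\<And>n. x \<in> W n" "decseq W"
    "\<And>U. openin X U \<Longrightarrow> x \<in> U \<Longrightarrow> \<exists>n. W n \<subseteq> U"
proof -
  obtain M d where M: "Metric_space M d" and X: "X = Metric_space.mtopology M d"
    using assms(1) unfolding metrizable_space_def by blast
  interpret Metric_space M d by (fact M)
  have x: "x \<in> M" using assms(2) X by simp
  show thesis
  proof (rule that[of "\<lambda>n. mball x (inverse (Suc n))"])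
    show "decseq (\<lambda>n. mball x (inverse (Suc n)))"
      by (intro decseq_SucI mball_subset_concentric) (simp add: field_simps)
    fix U assume "openin X U" "x \<in> U"
    then obtain r where r: "r > 0" "mball x r \<subseteq> U"
      using X openin_mtopology by blast
    obtain n where "inverse (real (Suc n)) < r" using reals_Archimedean[OF r(1)] by blast
    then have "mball x (inverse (Suc n)) \<subseteq> mball x r"
      by (intro mball_subset_concentric) simp
    then show "\<exists>n. mball x (inverse (real (Suc n))) \<subseteq> U" using r by blast
  qed (use x X in auto)
qed

subsection \<open>Topological groups and their quotients\<close>

context topological_group
begin

no_notation subset_mset (infix \<open><#\<close> 50)

lemma continuous_map_l_translation:
  assumes "a \<in> carrier G"
  shows "continuous_map T T (\<lambda>x. a \<otimes> x)"
proof -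
  have "continuous_map T (prod_topology T T) (\<lambda>x. (a, x))"
    using assms by (simp add: continuous_map_pairwise o_def topspace_eq_carrier)
  from continuous_map_compose[OF this continuous_map_mult] show ?thesis
    by (simp add: o_def)
qed

text \<open>The coset is the preimage of \<open>W\<close> under left translation by the inverse of
  \<open>a\<close>.\<close>

lemma openin_l_coset:
  assumes "openin T W" "a \<in> carrier G"
  shows "openin T (a <# W)"
proof -
  have W: "W \<subseteq> carrier G" using assms(1) openin_subset topspace_eq_carrier by blast
  have "openin T {x \<in> topspace T. inv a \<otimes> x \<in> W}"
    using continuous_map_l_translation[of "inv a"] assms openin_continuous_map_preimage by fastforce
  moreover have "{x \<in> topspace T. inv a \<otimes> x \<in> W} = a <# W"
  proof (intro subset_antisym subsetI)
    fix x assume "x \<in> {x \<in> topspace T. inv a \<otimes> x \<in> W}"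
    moreover from this have "x = a \<otimes> (inv a \<otimes> x)"
      using assms(2) by (simp add: topspace_eq_carrier m_assoc[symmetric])
    ultimately show "x \<in> a <# W" unfolding l_coset_def by blast
  next
    fix x assume "x \<in> a <# W"
    then obtain w where "w \<in> W" "x = a \<otimes> w" unfolding l_coset_def by blast
    then show "x \<in> {x \<in> topspace T. inv a \<otimes> x \<in> W}"
      using W assms(2) by (auto simp: topspace_eq_carrier m_assoc[symmetric] subsetD)
  qed
  ultimately show ?thesis by simp
qed

lemma mem_l_coset_self:
  assumes "a \<in> carrier G" "\<one> \<in> V"
  shows "a \<in> a <# V"
  using assms unfolding l_coset_def by force

lemma l_coset_mono: "V \<subseteq> W \<Longrightarrow> a <# V \<subseteq> a <# W"
  unfolding l_coset_def by blast

text \<open>Translate \<open>W\<close> back to the identity, intersect with an open part of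
  \<open>V\<^sub>0\<close>, pick a base member inside and translate forward again. The bound
  \<open>V\<^sub>0\<close> lets the Baire construction shrink the base members together with their
  cosets.\<close>

lemma l_coset_neighbourhood_base_subset:
  assumes B: "neighbourhood_base T \<one> B" and "openin T W" "a \<in> W" and V\<^sub>0: "neighbourhood_of T \<one> V\<^sub>0"
  obtains V where "V \<in> B" "V \<subseteq> V\<^sub>0" "a <# V \<subseteq> W"
proof -
  have a: "a \<in> carrier G" using assms openin_subset topspace_eq_carrier by blast
  obtain U where U: "openin T U" "\<one> \<in> U" "U \<subseteq> V\<^sub>0"
    using V\<^sub>0 unfolding neighbourhood_of_def by blast
  have open_int: "openin T (U \<inter> (inv a <# W))"
    using U(1) openin_l_coset[OF assms(2), of "inv a"] a by blast
  have "inv a \<otimes> a \<in> inv a <# W"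
    using assms(3) unfolding l_coset_def by blast
  then have "neighbourhood_of T \<one> (U \<inter> (inv a <# W))"
    using open_int U(2) a openin_subset unfolding neighbourhood_of_def by fastforce
  then obtain V where V: "V \<in> B" "V \<subseteq> U \<inter> (inv a <# W)"
    using B unfolding neighbourhood_base_def by blast
  have "W \<subseteq> carrier G" using assms openin_subset topspace_eq_carrier by blast
  then have "a <# (inv a <# W) = W"
    using a by (simp add: lcos_m_assoc lcos_mult_one)
  then have "a <# V \<subseteq> W"
    using l_coset_mono[of V "inv a <# W" a] V by auto
  then show thesis using that V U by blast
qed

text \<open>Base members may fail to be open; this provides the nonempty open set from which a
  nested construction can continue.\<close>

lemma interior_of_l_coset:
  assumes "a \<in> carrier G" "neighbourhood_of T \<one> V"
  shows "a \<in> T interior_of (a <# V)"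
proof -
  obtain U where "openin T U" "\<one> \<in> U" "U \<subseteq> V"
    using assms(2) unfolding neighbourhood_of_def by blast
  then have "openin T (a <# U)" "a \<in> a <# U" "a <# U \<subseteq> a <# V"
    by (simp_all add: assms(1) openin_l_coset mem_l_coset_self l_coset_mono)
  then show ?thesis unfolding interior_of_def by blast
qed

text \<open>The saturation of an open set \<open>W\<close> is the union of its translates by
  elements of \<open>N\<close>, hence open.\<close>

lemma open_map_coset:
  assumes "N \<lhd> G"
  shows "open_map T (quotient_topology T (\<lambda>x. N #> x)) (\<lambda>x. N #> x)"
  unfolding open_map_def
proof (intro allI impI)
  interpret normal N G by fact
  fix W assume W: "openin T W"
  then have sub: "W \<subseteq> carrier G" using openin_subset topspace_eq_carrier by blast
  have "{x \<in> topspace T. N #> x \<in> (\<lambda>x. N #> x) ` W} = (\<Union>n\<in>N. n <# W)"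
  proof (intro subset_antisym subsetI)
    fix x assume "x \<in> {x \<in> topspace T. N #> x \<in> (\<lambda>x. N #> x) ` W}"
    then obtain w where w: "x \<in> carrier G" "w \<in> W" "N #> x = N #> w"
      unfolding topspace_eq_carrier by blast
    then have "x \<in> N #> w" using rcos_self[OF w(1) is_subgroup] by simp
    then show "x \<in> (\<Union>n\<in>N. n <# W)"
      using w(2) unfolding r_coset_def l_coset_def by blast
  next
    fix x assume "x \<in> (\<Union>n\<in>N. n <# W)"
    then obtain n w where n: "n \<in> N" "w \<in> W" "x = n \<otimes> w"
      unfolding l_coset_def by blast
    have "w \<in> carrier G" using n sub by blast
    moreover have "x \<in> N #> w" using n unfolding r_coset_def by blast
    ultimately have "N #> w = N #> x" using repr_independence is_subgroup by blast
    then show "x \<in> {x \<in> topspace T. N #> x \<in> (\<lambda>x. N #> x) ` W}"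
      using n sub \<open>w \<in> carrier G\<close> unfolding topspace_eq_carrier by auto
  qed
  moreover have "openin T (\<Union>n\<in>N. n <# W)"
    using openin_l_coset[OF W] mem_carrier by blast
  ultimately show "openin (quotient_topology T (\<lambda>x. N #> x)) ((\<lambda>x. N #> x) ` W)"
    using openin_subset[OF W] by (auto simp: openin_quotient_topology)
qed

text \<open>Multiplication is checked on representatives and carried down by openness of the coset
  map; inversion follows from the universal property of the quotient map.\<close>

lemma topological_group_FactGroup:
  assumes "N \<lhd> G"
  shows "topological_group (G Mod N) (quotient_topology T (\<lambda>x. N #> x))"
proof -
  interpret normal N G by fact
  let ?p = "\<lambda>x. N #> x" and ?Q = "quotient_topology T (\<lambda>x. N #> x)"
  have Q: "topspace ?Q = rcosets N"
    by (auto simp: topspace_quotient_topology topspace_eq_carrier RCOSETS_def)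
  interpret Q: group "G Mod N" by (rule factorgroup_is_group)
  show ?thesis
  proof
    show "topspace ?Q = carrier (G Mod N)" by (simp add: Q FactGroup_def)
  next
    show "continuous_map (prod_topology ?Q ?Q) ?Q (\<lambda>(x, y). x \<otimes>\<^bsub>G Mod N\<^esub> y)"
      unfolding continuous_map_def
    proof (intro conjI allI impI)
      show "(\<lambda>(x, y). x \<otimes>\<^bsub>G Mod N\<^esub> y) \<in> topspace (prod_topology ?Q ?Q) \<rightarrow> topspace ?Q"
        using setmult_closed by (auto simp: Q)
      fix W assume W: "openin ?Q W"
      have W': "openin T {z \<in> topspace T. ?p z \<in> W}"
        using W by (simp add: openin_quotient_topology)
      have pre: "openin (prod_topology T T)
          {z \<in> topspace (prod_topology T T). (case z of (x, y) \<Rightarrow> x \<otimes> y) \<in> {z \<in> topspace T. ?p z \<in> W}}"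
        using openin_continuous_map_preimage[OF continuous_map_mult W'] .
      show "openin (prod_topology ?Q ?Q)
          {z \<in> topspace (prod_topology ?Q ?Q). (case z of (x, y) \<Rightarrow> x \<otimes>\<^bsub>G Mod N\<^esub> y) \<in> W}"
        unfolding openin_prod_topology_alt
      proof (intro allI impI)
        fix X Y
        assume XY: "(X, Y) \<in> {z \<in> topspace (prod_topology ?Q ?Q). (case z of (x, y) \<Rightarrow> x \<otimes>\<^bsub>G Mod N\<^esub> y) \<in> W}"
        then obtain x y where x: "x \<in> carrier G" "X = N #> x" and y: "y \<in> carrier G" "Y = N #> y"
          by (auto simp: topspace_quotient_topology topspace_eq_carrier)
        have "(x, y) \<in> {z \<in> topspace (prod_topology T T). (case z of (x, y) \<Rightarrow> x \<otimes> y) \<in> {z \<in> topspace T. ?p z \<in> W}}"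
          using XY x y by (auto simp: topspace_eq_carrier rcos_sum)
        then obtain A B where A: "openin T A" "x \<in> A" and B: "openin T B" "y \<in> B"
          and AB: "A \<times> B \<subseteq> {z \<in> topspace (prod_topology T T). (case z of (x, y) \<Rightarrow> x \<otimes> y) \<in> {z \<in> topspace T. ?p z \<in> W}}"
          using pre unfolding openin_prod_topology_alt by meson
        show "\<exists>U V. openin ?Q U \<and> openin ?Q V \<and> X \<in> U \<and> Y \<in> V \<and>
          U \<times> V \<subseteq> {z \<in> topspace (prod_topology ?Q ?Q). (case z of (x, y) \<Rightarrow> x \<otimes>\<^bsub>G Mod N\<^esub> y) \<in> W}"
        proof (intro exI conjI)
          \<comment> \<open>Elements of these open images have representatives in \<open>A\<close>
            and \<open>B\<close>, where the product is already known to land in the preimage of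
            \<open>W\<close>.\<close>
          show "openin ?Q (?p ` A)" "openin ?Q (?p ` B)"
            using A B open_map_coset[OF assms] unfolding open_map_def by auto
          show "?p ` A \<times> ?p ` B \<subseteq> {z \<in> topspace (prod_topology ?Q ?Q). (case z of (x, y) \<Rightarrow> x \<otimes>\<^bsub>G Mod N\<^esub> y) \<in> W}"
          proof (rule subrelI, elim SigmaE2 imageE, hypsubst)
            fix a b assume ab: "a \<in> A" "b \<in> B"
            then have "(a, b) \<in> A \<times> B" by simp
            with AB have "a \<in> carrier G" "b \<in> carrier G" "?p (a \<otimes> b) \<in> W"
              by (auto simp: topspace_eq_carrier)
            then show "(?p a, ?p b) \<in> {z \<in> topspace (prod_topology ?Q ?Q). (case z of (x, y) \<Rightarrow> x \<otimes>\<^bsub>G Mod N\<^esub> y) \<in> W}"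
              by (auto simp: topspace_quotient_topology topspace_eq_carrier rcos_sum)
          qed
        qed (use A B x y in auto)
      qed
    qed
  next
    have "continuous_map T ?Q (\<lambda>x. ?p (inv x))"
      using continuous_map_compose[OF continuous_map_inv
          quotient_imp_continuous_map[OF quotient_map_quotient_topology[of T ?p]]]
      by (simp add: o_def)
    then have "continuous_map T ?Q ((\<lambda>X. inv\<^bsub>G Mod N\<^esub> X) \<circ> ?p)"
    proof (rule continuous_map_eq)
      fix x assume "x \<in> topspace T"
      then have x: "x \<in> carrier G" by (simp add: topspace_eq_carrier)
      then have "N #> x \<in> carrier (G Mod N)" by (auto simp: FactGroup_def RCOSETS_def)
      then show "N #> inv x = ((\<lambda>X. inv\<^bsub>G Mod N\<^esub> X) \<circ> ?p) x"
        using x by (simp add: inv_FactGroup rcos_inv)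
    qed
    then show "continuous_map ?Q ?Q (\<lambda>X. inv\<^bsub>G Mod N\<^esub> X)"
      by (rule continuous_compose_quotient_map[OF quotient_map_quotient_topology])
  qed
qed

end

section \<open>Spherical completeness implies the Baire property\<close>

text \<open>If the union had interior, one could build inside it a decreasing sequence of cosets,
  the n-th avoiding the n-th closed set. Spherical completeness gives a common point, which would
  lie in the union but in none of its members.\<close>

lemma spherically_complete_imp_Baire_space:
  assumes "spherically_complete G T"
  shows "Baire_space T"
  unfolding Baire_space_def
proof (intro allI impI)
  interpret topological_group G T
    using assms unfolding spherically_complete_def by blast
  obtain B where B: "neighbourhood_base T \<one>\<^bsub>G\<^esub> B"
    and int: "\<forall>(V :: nat \<Rightarrow> 'a set) g. (\<forall>n. V n \<in> B) \<and> decseq V \<and> (\<forall>n. g n \<in> carrier G) \<and>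
       decseq (\<lambda>n. g n <#\<^bsub>G\<^esub> V n) \<longrightarrow> (\<Inter>n. g n <#\<^bsub>G\<^esub> V n) \<noteq> {}"
    using assms unfolding spherically_complete_def by (elim conjE exE)
  have B_nhd: "neighbourhood_of T \<one>\<^bsub>G\<^esub> V" if "V \<in> B" for V
    using B that unfolding neighbourhood_base_def by blast
  fix \<C> assume \<C>: "countable \<C> \<and> (\<forall>C\<in>\<C>. closedin T C \<and> T interior_of C = {})"
  show "T interior_of \<Union>\<C> = {}"
  proof (rule ccontr)
    assume ne: "T interior_of \<Union>\<C> \<noteq> {}"
    then have "\<C> \<noteq> {}" by auto
    \<comment> \<open>An enumeration of the closed sets, possibly with repetitions, so that finite
      and infinite families are treated alike.\<close>
    define c where "c = from_nat_into \<C>"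
    have c: "\<C> = range c" using \<open>\<C> \<noteq> {}\<close> \<C> by (simp add: c_def range_from_nat_into)
    let ?O = "T interior_of \<Union>\<C>"
    \<comment> \<open>A set with empty interior contains no nonempty open set, so
      \<open>W - c n\<close> is open and nonempty and has room for a small coset.\<close>
    have avoid: "\<exists>g V. g \<in> carrier G \<and> V \<in> B \<and> V \<subseteq> V\<^sub>0 \<and> g <#\<^bsub>G\<^esub> V \<subseteq> W - c n"
      if "openin T W" "W \<noteq> {}" "neighbourhood_of T \<one>\<^bsub>G\<^esub> V\<^sub>0" for W V\<^sub>0 n
    proof -
      have "openin T (W - c n)" using that(1) \<C> c by (auto intro: openin_diff)
      moreover have "W - c n \<noteq> {}"
      proof
        assume "W - c n = {}"
        then have "W \<subseteq> T interior_of c n" using that(1) by (simp add: interior_of_maximal)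
        then show False using that(2) \<C> c by auto
      qed
      ultimately obtain g where "openin T (W - c n)" "g \<in> W - c n" by blast
      moreover have "g \<in> carrier G"
        using calculation openin_subset topspace_eq_carrier by blast
      ultimately show ?thesis
        using l_coset_neighbourhood_base_subset[OF B _ _ that(3)] by metis
    qed
    \<comment> \<open>\<open>?P\<close> makes the n-th coset avoid \<open>c n\<close>;
      \<open>?R\<close> makes both the base members and their cosets decrease, as spherical
      completeness demands.\<close>
    let ?P = "\<lambda>n (g, V). g \<in> carrier G \<and> V \<in> B \<and> g <#\<^bsub>G\<^esub> V \<subseteq> ?O - c n"
    let ?R = "\<lambda>(n::nat) (g, V) (g', V'). V' \<subseteq> V \<and> g' <#\<^bsub>G\<^esub> V' \<subseteq> g <#\<^bsub>G\<^esub> V"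
    have "\<exists>f. \<forall>n. ?P n (f n) \<and> ?R n (f n) (f (Suc n))"
    proof (rule dependent_nat_choice)
      have "neighbourhood_of T \<one>\<^bsub>G\<^esub> (topspace T)"
        unfolding neighbourhood_of_def using topspace_eq_carrier by auto
      then show "\<exists>x. ?P 0 x"
        using avoid[OF openin_interior_of ne] by blast
    next
      fix x n assume P: "?P n x"
      obtain g V where x: "x = (g, V)" by (cases x)
      have g: "g \<in> carrier G" "V \<in> B" "g <#\<^bsub>G\<^esub> V \<subseteq> ?O" using P x by auto
      \<comment> \<open>The next coset is sought in the interior of the current one, since
        \<open>avoid\<close> starts from an open set.\<close>
      have "T interior_of (g <#\<^bsub>G\<^esub> V) \<noteq> {}"
        using interior_of_l_coset[OF g(1) B_nhd[OF g(2)]] by blast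
      from avoid[OF openin_interior_of this B_nhd[OF g(2)], of "Suc n"]
      obtain g' V' where "g' \<in> carrier G" "V' \<in> B" "V' \<subseteq> V"
        "g' <#\<^bsub>G\<^esub> V' \<subseteq> T interior_of (g <#\<^bsub>G\<^esub> V) - c (Suc n)" by blast
      then have "?P (Suc n) (g', V') \<and> ?R n x (g', V')"
        using g(3) x interior_of_subset[of T "g <#\<^bsub>G\<^esub> V"] by auto
      then show "\<exists>y. ?P (Suc n) y \<and> ?R n x y" by blast
    qed
    then obtain f where f: "\<forall>n. ?P n (f n) \<and> ?R n (f n) (f (Suc n))" ..
    have f1: "fst (f n) \<in> carrier G \<and> snd (f n) \<in> B \<and> fst (f n) <#\<^bsub>G\<^esub> snd (f n) \<subseteq> ?O - c n" for n
      using spec[OF f, of n] by (simp add: case_prod_beta)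
    have f2: "snd (f (Suc n)) \<subseteq> snd (f n) \<and>
        fst (f (Suc n)) <#\<^bsub>G\<^esub> snd (f (Suc n)) \<subseteq> fst (f n) <#\<^bsub>G\<^esub> snd (f n)" for n
      using spec[OF f, of n] by (simp add: case_prod_beta)
    have "decseq (\<lambda>n. snd (f n))" "decseq (\<lambda>n. fst (f n) <#\<^bsub>G\<^esub> snd (f n))"
      by (rule decseq_SucI, use f2 in metis)+
    then have "(\<Inter>n. fst (f n) <#\<^bsub>G\<^esub> snd (f n)) \<noteq> {}"
      using f1 by (intro int[rule_format]) simp
    then obtain x where x: "\<And>n. x \<in> fst (f n) <#\<^bsub>G\<^esub> snd (f n)" by blast
    then have "x \<in> ?O" "\<And>n. x \<notin> c n" using f1 by blast+
    then show False using interior_of_subset[of T "\<Union>\<C>"] c by auto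
  qed
qed

subsection \<open>Box products\<close>

text \<open>Open boxes are closed under binary intersection, taken coordinatewise, so they form a
  base and not only a subbase.\<close>

lemma openin_box_topology:
  "openin (box_topology I T) S \<longleftrightarrow>
     (\<forall>x\<in>S. \<exists>V. (\<forall>i\<in>I. openin (T i) (V i)) \<and> x \<in> PiE I V \<and> PiE I V \<subseteq> S)" (is "_ = ?rhs S")
proof
  assume "openin (box_topology I T) S"
  then have "generate_topology_on {PiE I V | V. \<forall>i\<in>I. openin (T i) (V i)} S"
    unfolding box_topology_def by (rule openin_topology_generated_by)
  then show "?rhs S"
  proof induction
    case (Int A B)
    show ?case
    proof
      fix x assume "x \<in> A \<inter> B"
      then have "x \<in> A" "x \<in> B" by auto
      obtain V where V: "\<forall>i\<in>I. openin (T i) (V i)" "x \<in> PiE I V" "PiE I V \<subseteq> A"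
        using bspec[OF Int.IH(1) \<open>x \<in> A\<close>] by (elim exE conjE)
      obtain W where W: "\<forall>i\<in>I. openin (T i) (W i)" "x \<in> PiE I W" "PiE I W \<subseteq> B"
        using bspec[OF Int.IH(2) \<open>x \<in> B\<close>] by (elim exE conjE)
      from V W show "\<exists>V. (\<forall>i\<in>I. openin (T i) (V i)) \<and> x \<in> PiE I V \<and> PiE I V \<subseteq> A \<inter> B"
        by (intro exI[of _ "\<lambda>i. V i \<inter> W i"]) (auto simp: PiE_Int[symmetric])
    qed
  next
    case (UN K)
    then show ?case by (meson Union_iff Sup_upper order_trans)
  qed blast+
next
  assume R: "?rhs S"
  show "openin (box_topology I T) S"
  proof (subst openin_subopen, intro ballI)
    fix x assume "x \<in> S"
    with R obtain V where "\<forall>i\<in>I. openin (T i) (V i)" "x \<in> PiE I V" "PiE I V \<subseteq> S" by blast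
    moreover from this have "openin (box_topology I T) (PiE I V)"
      unfolding box_topology_def by (blast intro: topology_generated_by_Basis)
    ultimately show "\<exists>U. openin (box_topology I T) U \<and> x \<in> U \<and> U \<subseteq> S" by blast
  qed
qed

lemma openin_box_topology_PiE:
  assumes "\<And>i. i \<in> I \<Longrightarrow> openin (T i) (V i)"
  shows "openin (box_topology I T) (PiE I V)"
  using assms unfolding openin_box_topology by blast

text \<open>Continuity can be verified in each coordinate independently: the neighbourhoods found in
  the factors, over all of \<open>I\<close> at once, multiply to an open box.\<close>

lemma topological_group_box_topology:
  assumes "\<And>i. i \<in> I \<Longrightarrow> topological_group (G i) (T i)"
  shows "topological_group (product_group I G) (box_topology I T)"
proof -
  have grp: "group (G i)" if "i \<in> I" for i
    using assms[OF that] by (simp add: topological_group_def)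
  have top: "topspace (T i) = carrier (G i)" if "i \<in> I" for i
    by (rule topological_group.topspace_eq_carrier[OF assms[OF that]])
  interpret group "product_group I G" using grp by simp
  let ?X = "box_topology I T"
  have X: "topspace ?X = carrier (product_group I G)"
    using top by (auto simp: topspace_box_topology PiE_iff)
  show ?thesis
  proof
    show "topspace ?X = carrier (product_group I G)" by (fact X)
  next
    show "continuous_map (prod_topology ?X ?X) ?X (\<lambda>(x, y). x \<otimes>\<^bsub>product_group I G\<^esub> y)"
      unfolding continuous_map_def
    proof (intro conjI allI impI)
      show "(\<lambda>(x, y). x \<otimes>\<^bsub>product_group I G\<^esub> y) \<in> topspace (prod_topology ?X ?X) \<rightarrow> topspace ?X"
        using m_closed by (auto simp: X simp del: carrier_product_group mult_product_group)
      fix W assume W: "openin ?X W"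
      show "openin (prod_topology ?X ?X)
          {z \<in> topspace (prod_topology ?X ?X). (case z of (x, y) \<Rightarrow> x \<otimes>\<^bsub>product_group I G\<^esub> y) \<in> W}"
        unfolding openin_prod_topology_alt
      proof (intro allI impI)
        fix x y
        assume "(x, y) \<in> {z \<in> topspace (prod_topology ?X ?X). (case z of (x, y) \<Rightarrow> x \<otimes>\<^bsub>product_group I G\<^esub> y) \<in> W}"
        then have xy: "x \<in> (\<Pi>\<^sub>E i\<in>I. carrier (G i))" "y \<in> (\<Pi>\<^sub>E i\<in>I. carrier (G i))"
          "(\<lambda>i\<in>I. x i \<otimes>\<^bsub>G i\<^esub> y i) \<in> W"
          by (auto simp: X)
        then obtain V where V: "\<forall>i\<in>I. openin (T i) (V i)" "PiE I V \<subseteq> W"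
          "(\<lambda>i\<in>I. x i \<otimes>\<^bsub>G i\<^esub> y i) \<in> PiE I V"
          using W unfolding openin_box_topology by meson
        have "\<exists>A B. openin (T i) A \<and> openin (T i) B \<and> x i \<in> A \<and> y i \<in> B \<and>
            (\<forall>a\<in>A. \<forall>b\<in>B. a \<otimes>\<^bsub>G i\<^esub> b \<in> V i)" if i: "i \<in> I" for i
        proof -
          have *: "openin (prod_topology (T i) (T i)) {z \<in> topspace (prod_topology (T i) (T i)).
              (case z of (x, y) \<Rightarrow> x \<otimes>\<^bsub>G i\<^esub> y) \<in> V i}"
            using openin_continuous_map_preimage
              [OF topological_group.continuous_map_mult[OF assms[OF i]]] V(1) i by blast
          have "(x i, y i) \<in> {z \<in> topspace (prod_topology (T i) (T i)).
              (case z of (x, y) \<Rightarrow> x \<otimes>\<^bsub>G i\<^esub> y) \<in> V i}"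
            using xy V(3) i top by (auto simp: PiE_iff)
          then obtain A B where "openin (T i) A" "openin (T i) B" "x i \<in> A" "y i \<in> B"
            "A \<times> B \<subseteq> {z \<in> topspace (prod_topology (T i) (T i)).
              (case z of (x, y) \<Rightarrow> x \<otimes>\<^bsub>G i\<^esub> y) \<in> V i}"
            using * unfolding openin_prod_topology_alt by meson
          then show ?thesis by (intro exI[of _ A] exI[of _ B]) auto
        qed
        \<comment> \<open>The neighbourhoods in the separate coordinates are collected into two
          families, whose products are the required boxes around \<open>x\<close> and
          \<open>y\<close>.\<close>
        from bchoice[OF ballI[OF this]] obtain A where
          "\<forall>i\<in>I. \<exists>B. openin (T i) (A i) \<and> openin (T i) B \<and> x i \<in> A i \<and> y i \<in> B \<and>
            (\<forall>a\<in>A i. \<forall>b\<in>B. a \<otimes>\<^bsub>G i\<^esub> b \<in> V i)" ..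
        from bchoice[OF this] obtain B where
          "\<forall>i\<in>I. openin (T i) (A i) \<and> openin (T i) (B i) \<and> x i \<in> A i \<and> y i \<in> B i \<and>
            (\<forall>a\<in>A i. \<forall>b\<in>B i. a \<otimes>\<^bsub>G i\<^esub> b \<in> V i)" ..
        then have AB: "\<And>i. i \<in> I \<Longrightarrow> openin (T i) (A i)" "\<And>i. i \<in> I \<Longrightarrow> openin (T i) (B i)"
          "\<And>i. i \<in> I \<Longrightarrow> x i \<in> A i" "\<And>i. i \<in> I \<Longrightarrow> y i \<in> B i"
          "\<And>i a b. \<lbrakk>i \<in> I; a \<in> A i; b \<in> B i\<rbrakk> \<Longrightarrow> a \<otimes>\<^bsub>G i\<^esub> b \<in> V i"
          by blast+
        have sub: "PiE I A \<subseteq> topspace ?X" "PiE I B \<subseteq> topspace ?X"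
          using AB openin_box_topology_PiE[THEN openin_subset] by metis+
        show "\<exists>U V. openin ?X U \<and> openin ?X V \<and> x \<in> U \<and> y \<in> V \<and>
          U \<times> V \<subseteq> {z \<in> topspace (prod_topology ?X ?X). (case z of (x, y) \<Rightarrow> x \<otimes>\<^bsub>product_group I G\<^esub> y) \<in> W}"
        proof (intro exI conjI)
          show "openin ?X (PiE I A)" "openin ?X (PiE I B)"
            using AB by (auto intro: openin_box_topology_PiE)
          show "x \<in> PiE I A" "y \<in> PiE I B" using xy AB by (auto simp: PiE_iff)
          have "(\<lambda>i\<in>I. a i \<otimes>\<^bsub>G i\<^esub> b i) \<in> W" if "a \<in> PiE I A" "b \<in> PiE I B" for a b
            using that AB(5) V(2) by (auto simp: PiE_iff)
          then show "PiE I A \<times> PiE I B \<subseteq> {z \<in> topspace (prod_topology ?X ?X).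
              (case z of (x, y) \<Rightarrow> x \<otimes>\<^bsub>product_group I G\<^esub> y) \<in> W}"
            using sub by auto
        qed
      qed
    qed
  next
    show "continuous_map ?X ?X (\<lambda>x. inv\<^bsub>product_group I G\<^esub> x)"
      unfolding continuous_map_def
    proof (intro conjI allI impI)
      show "(\<lambda>x. inv\<^bsub>product_group I G\<^esub> x) \<in> topspace ?X \<rightarrow> topspace ?X"
        unfolding X by (blast intro: inv_closed)
      fix W assume W: "openin ?X W"
      show "openin ?X {x \<in> topspace ?X. inv\<^bsub>product_group I G\<^esub> x \<in> W}"
        unfolding openin_box_topology
      proof
        fix x assume "x \<in> {x \<in> topspace ?X. inv\<^bsub>product_group I G\<^esub> x \<in> W}"
        then have x: "x \<in> (\<Pi>\<^sub>E i\<in>I. carrier (G i))" "(\<lambda>i\<in>I. inv\<^bsub>G i\<^esub> x i) \<in> W"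
          using grp by (auto simp: X)
        then obtain V where V: "\<forall>i\<in>I. openin (T i) (V i)" "PiE I V \<subseteq> W"
          "(\<lambda>i\<in>I. inv\<^bsub>G i\<^esub> x i) \<in> PiE I V"
          using W unfolding openin_box_topology by meson
        let ?V = "\<lambda>i. {a \<in> topspace (T i). inv\<^bsub>G i\<^esub> a \<in> V i}"
        have "\<forall>i\<in>I. openin (T i) (?V i)"
          using openin_continuous_map_preimage[OF topological_group.continuous_map_inv[OF assms]] V(1)
          by blast
        moreover have "x \<in> PiE I ?V" using x V(3) top by (auto simp: PiE_iff)
        moreover have "PiE I ?V \<subseteq> {x \<in> topspace ?X. inv\<^bsub>product_group I G\<^esub> x \<in> W}"
        proof
          fix a assume a: "a \<in> PiE I ?V"
          then have "a \<in> carrier (product_group I G)" "(\<lambda>i\<in>I. inv\<^bsub>G i\<^esub> a i) \<in> PiE I V"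
            using top by (auto simp: PiE_iff)
          moreover from this have "(\<lambda>i\<in>I. inv\<^bsub>G i\<^esub> a i) \<in> W" using V(2) by blast
          ultimately show "a \<in> {x \<in> topspace ?X. inv\<^bsub>product_group I G\<^esub> x \<in> W}"
            using grp X by simp
        qed
        ultimately show "\<exists>V. (\<forall>i\<in>I. openin (T i) (V i)) \<and> x \<in> PiE I V \<and>
            PiE I V \<subseteq> {x \<in> topspace ?X. inv\<^bsub>product_group I G\<^esub> x \<in> W}"
          by (intro exI[of _ ?V] conjI)
      qed
    qed
  qed
qed


subsection \<open>Ultraproducts over countable index sets\<close>

locale countable_ultraproduct =
  fixes I :: "'i set"
    and G :: "'i \<Rightarrow> ('a, 'b) monoid_scheme"
    and T :: "'i \<Rightarrow> 'a topology"
    and \<U> :: "'i set set"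
  assumes countable_index: "countable I"
    and topological_group: "\<And>i. i \<in> I \<Longrightarrow> topological_group (G i) (T i)"
    and ultrafilter: "ultrafilter_on I \<U>"
    and nonprincipal: "\<not> principal_ultrafilter_on I \<U>"
begin

section \<open>Non-principal ultrafilters on a countable set\<close>

lemma ultrafilter_subset: "A \<in> \<U> \<Longrightarrow> A \<subseteq> I"
  using ultrafilter unfolding ultrafilter_on_def by blast

lemma ultrafilter_mono: "\<lbrakk>A \<in> \<U>; A \<subseteq> B; B \<subseteq> I\<rbrakk> \<Longrightarrow> B \<in> \<U>"
  using ultrafilter unfolding ultrafilter_on_def by metis

lemma ultrafilter_Int: "\<lbrakk>A \<in> \<U>; B \<in> \<U>\<rbrakk> \<Longrightarrow> A \<inter> B \<in> \<U>"
  using ultrafilter unfolding ultrafilter_on_def by metis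

lemma ultrafilter_top: "I \<in> \<U>"
  using ultrafilter unfolding ultrafilter_on_def by metis

lemma ultrafilter_nonempty: "{} \<notin> \<U>"
  using ultrafilter unfolding ultrafilter_on_def by metis

text \<open>Otherwise the singleton of \<open>i\<close> belongs to the ultrafilter, which is then
  the principal one at \<open>i\<close>.\<close>

lemma ultrafilter_Diff_singleton:
  assumes "i \<in> I"
  shows "I - {i} \<in> \<U>"
proof (rule ccontr)
  assume "I - {i} \<notin> \<U>"
  then have i: "{i} \<in> \<U>"
    using ultrafilter assms unfolding ultrafilter_on_def by (metis empty_subsetI insert_subset)
  have "\<U> = {A. A \<subseteq> I \<and> i \<in> A}"
  proof (intro equalityI subsetI)
    fix A assume A: "A \<in> \<U>"
    have "i \<in> A"
      using ultrafilter_Int[OF A i] ultrafilter_nonempty by (cases "i \<in> A") auto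
    then show "A \<in> {A. A \<subseteq> I \<and> i \<in> A}" using ultrafilter_subset[OF A] by simp
  next
    fix A assume "A \<in> {A. A \<subseteq> I \<and> i \<in> A}"
    then show "A \<in> \<U>" using ultrafilter_mono[OF i, of A] by simp
  qed
  then show False using nonprincipal assms unfolding principal_ultrafilter_on_def by blast
qed

lemma ultrafilter_Diff_finite:
  assumes "finite F" "F \<subseteq> I"
  shows "I - F \<in> \<U>"
  using assms
proof (induction F)
  case empty
  then show ?case using ultrafilter_top by simp
next
  case (insert i F)
  then have "(I - F) \<inter> (I - {i}) \<in> \<U>"
    using ultrafilter_Int ultrafilter_Diff_singleton by simp
  moreover have "(I - F) \<inter> (I - {i}) = I - insert i F" by blast
  ultimately show ?case by simp
qed

text \<open>The injective enumeration \<open>to_nat_on I\<close> leaves only finitely many indices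
  below \<open>n\<close>. All diagonal arguments below draw on countability and non-principality
  through this fact.\<close>

lemma ultrafilter_tail: "{i \<in> I. n \<le> to_nat_on I i} \<in> \<U>"
proof -
  have "finite {i \<in> I. to_nat_on I i < n}"
  proof (rule finite_imageD)
    show "finite (to_nat_on I ` {i \<in> I. to_nat_on I i < n})"
      by (rule finite_subset[of _ "{..<n}"]) auto
    show "inj_on (to_nat_on I) {i \<in> I. to_nat_on I i < n}"
      using inj_on_to_nat_on[OF countable_index] by (rule inj_on_subset) blast
  qed
  then have "I - {i \<in> I. to_nat_on I i < n} \<in> \<U>"
    by (rule ultrafilter_Diff_finite) blast
  moreover have "I - {i \<in> I. to_nat_on I i < n} = {i \<in> I. n \<le> to_nat_on I i}" by auto
  ultimately show ?thesis by simp
qed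

lemma ultrafilter_finite_INT:
  assumes "\<And>k. k \<le> n \<Longrightarrow> {i \<in> I. Q k i} \<in> \<U>"
  shows "{i \<in> I. \<forall>k\<le>(n::nat). Q k i} \<in> \<U>"
  using assms
proof (induction n)
  case 0
  then show ?case by simp
next
  case (Suc n)
  then have "{i \<in> I. \<forall>k\<le>n. Q k i} \<inter> {i \<in> I. Q (Suc n) i} \<in> \<U>"
    by (intro ultrafilter_Int) auto
  moreover have "{i \<in> I. \<forall>k\<le>n. Q k i} \<inter> {i \<in> I. Q (Suc n) i} = {i \<in> I. \<forall>k\<le>Suc n. Q k i}"
    by (auto simp: le_Suc_eq)
  ultimately show ?case by simp
qed

section \<open>The kernel, its cosets and internal sets\<close>

abbreviation "N \<equiv> ultraproduct_kernel I G \<U>"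
abbreviation "\<pi> \<equiv> \<lambda>g. N #>\<^bsub>product_group I G\<^esub> g"

lemma group: "i \<in> I \<Longrightarrow> group (G i)"
  using topological_group by (simp add: topological_group_def)

lemma topspace_factor: "i \<in> I \<Longrightarrow> topspace (T i) = carrier (G i)"
  by (rule topological_group.topspace_eq_carrier[OF topological_group])

sublocale P: topological_group "product_group I G" "box_topology I T"
  by (rule topological_group_box_topology[OF topological_group])

lemma kernel_subgroup: "subgroup N (product_group I G)"
proof
  show "N \<subseteq> carrier (product_group I G)" unfolding ultraproduct_kernel_def by blast
next
  fix x y assume "x \<in> N" "y \<in> N"
  then have x: "x \<in> (\<Pi>\<^sub>E i\<in>I. carrier (G i))" "{i \<in> I. x i = \<one>\<^bsub>G i\<^esub>} \<in> \<U>"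
    and y: "y \<in> (\<Pi>\<^sub>E i\<in>I. carrier (G i))" "{i \<in> I. y i = \<one>\<^bsub>G i\<^esub>} \<in> \<U>"
    unfolding ultraproduct_kernel_def by auto
  have "{i \<in> I. (x \<otimes>\<^bsub>product_group I G\<^esub> y) i = \<one>\<^bsub>G i\<^esub>} \<in> \<U>"
    by (rule ultrafilter_mono[OF ultrafilter_Int[OF x(2) y(2)]])
      (auto simp: group.is_monoid group)
  moreover have "x \<otimes>\<^bsub>product_group I G\<^esub> y \<in> carrier (product_group I G)"
    by (rule P.m_closed) (use x y in auto)
  ultimately show "x \<otimes>\<^bsub>product_group I G\<^esub> y \<in> N" unfolding ultraproduct_kernel_def by blast
next
  show "\<one>\<^bsub>product_group I G\<^esub> \<in> N"
    unfolding ultraproduct_kernel_def using P.one_closed ultrafilter_top by simp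
next
  fix x assume "x \<in> N"
  then have x: "x \<in> (\<Pi>\<^sub>E i\<in>I. carrier (G i))" "{i \<in> I. x i = \<one>\<^bsub>G i\<^esub>} \<in> \<U>"
    unfolding ultraproduct_kernel_def by auto
  have "{i \<in> I. (inv\<^bsub>product_group I G\<^esub> x) i = \<one>\<^bsub>G i\<^esub>} \<in> \<U>"
    by (rule ultrafilter_mono[OF x(2)]) (use x(1) in \<open>auto simp: group group.is_monoid monoid.inv_one\<close>)
  moreover have "inv\<^bsub>product_group I G\<^esub> x \<in> carrier (product_group I G)"
    by (rule P.inv_closed) (use x in auto)
  ultimately show "inv\<^bsub>product_group I G\<^esub> x \<in> N" unfolding ultraproduct_kernel_def by blast
qed

text \<open>Conjugation keeps trivial every coordinate in which \<open>h\<close> is trivial.\<close>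

lemma kernel_normal: "N \<lhd> product_group I G"
  unfolding P.normal_inv_iff
proof (intro conjI ballI kernel_subgroup)
  fix x h assume x: "x \<in> carrier (product_group I G)" and "h \<in> N"
  then have h: "h \<in> (\<Pi>\<^sub>E i\<in>I. carrier (G i))" "{i \<in> I. h i = \<one>\<^bsub>G i\<^esub>} \<in> \<U>"
    unfolding ultraproduct_kernel_def by auto
  have xi: "x i \<in> carrier (G i)" if "i \<in> I" for i using x that by (auto simp: PiE_iff)
  have "{i \<in> I. (x \<otimes>\<^bsub>product_group I G\<^esub> h \<otimes>\<^bsub>product_group I G\<^esub> inv\<^bsub>product_group I G\<^esub> x) i = \<one>\<^bsub>G i\<^esub>} \<in> \<U>"
    by (rule ultrafilter_mono[OF h(2)])
      (use x xi in \<open>auto simp: group group.is_monoid group.r_inv\<close>)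
  moreover have "x \<otimes>\<^bsub>product_group I G\<^esub> h \<otimes>\<^bsub>product_group I G\<^esub> inv\<^bsub>product_group I G\<^esub> x \<in> carrier (product_group I G)"
    by (intro P.m_closed P.inv_closed x) (use h in auto)
  ultimately show "x \<otimes>\<^bsub>product_group I G\<^esub> h \<otimes>\<^bsub>product_group I G\<^esub> inv\<^bsub>product_group I G\<^esub> x \<in> N"
    unfolding ultraproduct_kernel_def by blast
qed

sublocale N: normal N "product_group I G"
  by (rule kernel_normal)

sublocale B: topological_group "Bankston_group I G \<U>" "Bankston_topology I G T \<U>"
  unfolding Bankston_group_def Bankston_topology_def
  by (rule P.topological_group_FactGroup[OF kernel_normal])

lemma carrier_Bankston: "carrier (Bankston_group I G \<U>) = \<pi> ` (\<Pi>\<^sub>E i\<in>I. carrier (G i))"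
  by (simp add: Bankston_group_def carrier_FactGroup)

lemma one_Bankston: "\<one>\<^bsub>Bankston_group I G \<U>\<^esub> = \<pi> (\<lambda>i\<in>I. \<one>\<^bsub>G i\<^esub>)"
  using P.coset_mult_one[OF N.subset] by (simp add: Bankston_group_def)

text \<open>Equality of cosets means that x times the inverse of y lies in \<open>N\<close>, and
  this quotient is trivial exactly in the coordinates where x and y agree.\<close>

lemma coset_eq_iff:
  assumes "x \<in> (\<Pi>\<^sub>E i\<in>I. carrier (G i))" "y \<in> (\<Pi>\<^sub>E i\<in>I. carrier (G i))"
  shows "\<pi> x = \<pi> y \<longleftrightarrow> {i \<in> I. x i = y i} \<in> \<U>"
proof -
  have x: "x \<in> carrier (product_group I G)" and y: "y \<in> carrier (product_group I G)"
    using assms by auto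
  have "\<pi> x = \<pi> y \<longleftrightarrow> x \<in> \<pi> y"
    using P.repr_independence[OF _ y kernel_subgroup] P.rcos_self[OF x kernel_subgroup] by metis
  also have "\<dots> \<longleftrightarrow> x \<otimes>\<^bsub>product_group I G\<^esub> inv\<^bsub>product_group I G\<^esub> y \<in> N"
    using N.rcos_module[OF P.is_group y x] .
  also have "\<dots> \<longleftrightarrow> {i \<in> I. (x \<otimes>\<^bsub>product_group I G\<^esub> inv\<^bsub>product_group I G\<^esub> y) i = \<one>\<^bsub>G i\<^esub>} \<in> \<U>"
    using P.m_closed[OF x P.inv_closed[OF y]] unfolding ultraproduct_kernel_def by blast
  also have "{i \<in> I. (x \<otimes>\<^bsub>product_group I G\<^esub> inv\<^bsub>product_group I G\<^esub> y) i = \<one>\<^bsub>G i\<^esub>} = {i \<in> I. x i = y i}"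
  proof (intro Collect_cong conj_cong refl)
    fix i assume i: "i \<in> I"
    then have "x i \<in> carrier (G i)" "y i \<in> carrier (G i)" using assms by (auto simp: PiE_iff)
    then have "x i \<otimes>\<^bsub>G i\<^esub> inv\<^bsub>G i\<^esub> y i = \<one>\<^bsub>G i\<^esub> \<longleftrightarrow> x i = y i"
      using group[OF i] by (metis group.inv_equality group.inv_inv group.r_inv group.inv_closed)
    then show "(x \<otimes>\<^bsub>product_group I G\<^esub> inv\<^bsub>product_group I G\<^esub> y) i = \<one>\<^bsub>G i\<^esub> \<longleftrightarrow> x i = y i"
      using assms i by (simp add: group)
  qed
  finally show ?thesis .
qed

text \<open>Membership in an internal set is read off coordinatewise modulo the ultrafilter.
  Nonempty factors make it possible to correct a representative in the remaining
  coordinates.\<close>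

lemma coset_mem_image_iff:
  assumes x: "x \<in> (\<Pi>\<^sub>E i\<in>I. carrier (G i))"
    and P: "\<And>i. i \<in> I \<Longrightarrow> P i \<subseteq> carrier (G i)" "\<And>i. i \<in> I \<Longrightarrow> P i \<noteq> {}"
  shows "\<pi> x \<in> \<pi> ` PiE I P \<longleftrightarrow> {i \<in> I. x i \<in> P i} \<in> \<U>"
proof
  assume "\<pi> x \<in> \<pi> ` PiE I P"
  then obtain y where y: "y \<in> PiE I P" "\<pi> x = \<pi> y" by blast
  have "y \<in> (\<Pi>\<^sub>E i\<in>I. carrier (G i))" using y(1) PiE_mono[of I P] P(1) by blast
  then have "{i \<in> I. x i = y i} \<in> \<U>" using y(2) coset_eq_iff[OF x] by simp
  then show "{i \<in> I. x i \<in> P i} \<in> \<U>"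
    by (rule ultrafilter_mono) (use y in \<open>auto simp: PiE_iff\<close>)
next
  assume U: "{i \<in> I. x i \<in> P i} \<in> \<U>"
  obtain p where p: "p \<in> PiE I P" using P(2) by (metis PiE_eq_empty_iff ex_in_conv)
  \<comment> \<open>\<open>y\<close> keeps \<open>x\<close> wherever \<open>x i\<close> is already
    in \<open>P i\<close> and takes the default \<open>p i\<close> elsewhere; this changes
    \<open>x\<close> only off a set of the ultrafilter.\<close>
  define y where "y = (\<lambda>i\<in>I. if x i \<in> P i then x i else p i)"
  have y: "y \<in> PiE I P" using p by (auto simp: y_def PiE_iff)
  then have "y \<in> (\<Pi>\<^sub>E i\<in>I. carrier (G i))" using PiE_mono[of I P] P(1) by blast
  moreover have "{i \<in> I. x i = y i} \<in> \<U>"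
    by (rule ultrafilter_mono[OF U]) (auto simp: y_def)
  ultimately have "\<pi> x = \<pi> y" using coset_eq_iff[OF x] by simp
  then show "\<pi> x \<in> \<pi> ` PiE I P" using y by simp
qed

text \<open>Translation commutes with the quotient map and acts coordinatewise on the box, so
  translates of internal sets are internal.\<close>

lemma l_coset_image_PiE:
  assumes h: "h \<in> (\<Pi>\<^sub>E i\<in>I. carrier (G i))"
    and V: "\<And>i. i \<in> I \<Longrightarrow> V i \<subseteq> carrier (G i)"
  shows "\<pi> h <#\<^bsub>Bankston_group I G \<U>\<^esub> (\<pi> ` PiE I V) = \<pi> ` (\<Pi>\<^sub>E i\<in>I. h i <#\<^bsub>G i\<^esub> V i)"
proof -
  have "\<pi> h <#\<^bsub>Bankston_group I G \<U>\<^esub> (\<pi> ` PiE I V)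
      = (\<lambda>v. \<pi> h \<otimes>\<^bsub>Bankston_group I G \<U>\<^esub> \<pi> v) ` PiE I V"
    by (auto simp: l_coset_def)
  also have "\<dots> = (\<lambda>v. \<pi> (h \<otimes>\<^bsub>product_group I G\<^esub> v)) ` PiE I V"
  proof (rule image_cong[OF refl])
    fix v assume "v \<in> PiE I V"
    then have "v \<in> carrier (product_group I G)" using V by (simp add: PiE_iff) blast
    then show "\<pi> h \<otimes>\<^bsub>Bankston_group I G \<U>\<^esub> \<pi> v = \<pi> (h \<otimes>\<^bsub>product_group I G\<^esub> v)"
      using h N.rcos_sum[of h v] by (simp add: Bankston_group_def)
  qed
  also have "\<dots> = \<pi> ` ((\<lambda>v. h \<otimes>\<^bsub>product_group I G\<^esub> v) ` PiE I V)" by (simp add: image_image)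
  also have "(\<lambda>v. h \<otimes>\<^bsub>product_group I G\<^esub> v) ` PiE I V = (\<Pi>\<^sub>E i\<in>I. h i <#\<^bsub>G i\<^esub> V i)"
  proof (intro subset_antisym subsetI)
    fix y assume "y \<in> (\<lambda>v. h \<otimes>\<^bsub>product_group I G\<^esub> v) ` PiE I V"
    then show "y \<in> (\<Pi>\<^sub>E i\<in>I. h i <#\<^bsub>G i\<^esub> V i)" by (auto simp: PiE_iff l_coset_def)
  next
    fix y assume y: "y \<in> (\<Pi>\<^sub>E i\<in>I. h i <#\<^bsub>G i\<^esub> V i)"
    then have "\<forall>i\<in>I. \<exists>v. v \<in> V i \<and> y i = h i \<otimes>\<^bsub>G i\<^esub> v" by (auto simp: PiE_iff l_coset_def)
    from bchoice[OF this] obtain v where "\<forall>i\<in>I. v i \<in> V i \<and> y i = h i \<otimes>\<^bsub>G i\<^esub> v i" ..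
    \<comment> \<open>Restriction is needed because members of \<open>PiE I V\<close> are undefined
      off \<open>I\<close>.\<close>
    then have "restrict v I \<in> PiE I V" "y = h \<otimes>\<^bsub>product_group I G\<^esub> restrict v I"
      using y by (auto simp: PiE_iff extensional_def fun_eq_iff)
    then show "y \<in> (\<lambda>v. h \<otimes>\<^bsub>product_group I G\<^esub> v) ` PiE I V" by blast
  qed
  finally show ?thesis .
qed

text \<open>Countable saturation. Only the images decrease, so the boxes themselves are nested
  merely modulo the ultrafilter; the diagonal choice has to cope with exceptional
  coordinates.\<close>

lemma decseq_images_INT_nonempty:
  assumes sub: "\<And>n i. i \<in> I \<Longrightarrow> P n i \<subseteq> carrier (G i)"
    and ne: "\<And>n i. i \<in> I \<Longrightarrow> P n i \<noteq> {}"
    and dec: "decseq (\<lambda>n. \<pi> ` PiE I (P n))"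
  shows "(\<Inter>n. \<pi> ` PiE I (P n)) \<noteq> {}"
proof -
  have "\<exists>h. h \<in> PiE I (P n)" for n using ne by (metis PiE_eq_empty_iff ex_in_conv)
  then obtain h where h: "\<And>n. h n \<in> PiE I (P n)" by metis
  have hc: "h n \<in> (\<Pi>\<^sub>E i\<in>I. carrier (G i))" for n using h[of n] PiE_mono[of I "P n"] sub by blast
  have hk: "\<pi> (h n) \<in> \<pi> ` PiE I (P k)" if "k \<le> n" for k n
    using decseqD[OF dec that] h[of n] by blast
  have "{i \<in> I. h n i \<in> P k i} \<in> \<U>" if "k \<le> n" for k n
    using coset_mem_image_iff[where P = "P k" and x = "h n", OF hc sub ne] hk[OF that] by simp
  \<comment> \<open>For each \<open>n\<close>, the representative \<open>h n\<close> meets the first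
    n+1 conditions simultaneously on a large set of coordinates.\<close>
  then have D: "{i \<in> I. \<forall>k\<le>n. h n i \<in> P k i} \<in> \<U>" for n
    by (intro ultrafilter_finite_INT)
  \<comment> \<open>In coordinate \<open>i\<close>, follow the centre of the last set, among those indexed up to the position of \<open>i\<close>,
    whose centre still lies in all earlier sets.\<close>
  define S where "S i = {m. m \<le> to_nat_on I i \<and> (\<forall>k\<le>m. h m i \<in> P k i)}" for i
  define x where "x = (\<lambda>i\<in>I. h (Max (S i)) i)"
  have fin: "finite (S i)" for i
    by (rule finite_subset[of _ "{..to_nat_on I i}"]) (auto simp: S_def)
  have x: "x \<in> (\<Pi>\<^sub>E i\<in>I. carrier (G i))" using hc by (auto simp: x_def PiE_iff)
  have "\<pi> x \<in> \<pi> ` PiE I (P n)" for n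
  proof -
    have "{i \<in> I. x i \<in> P n i} \<in> \<U>"
    \<comment> \<open>On this intersection \<open>n\<close> itself is admissible, so the maximum of
      \<open>S i\<close> is at least \<open>n\<close>, and the value chosen there satisfies
      condition \<open>n\<close> among the others.\<close>
    proof (rule ultrafilter_mono[OF ultrafilter_Int[OF D[of n] ultrafilter_tail[of n]]])
      show "{i \<in> I. \<forall>k\<le>n. h n i \<in> P k i} \<inter> {i \<in> I. n \<le> to_nat_on I i} \<subseteq> {i \<in> I. x i \<in> P n i}"
      proof
        fix i assume i: "i \<in> {i \<in> I. \<forall>k\<le>n. h n i \<in> P k i} \<inter> {i \<in> I. n \<le> to_nat_on I i}"
        then have "n \<in> S i" by (simp add: S_def)
        then have "n \<le> Max (S i)" "Max (S i) \<in> S i" using fin[of i] Max_ge Max_in by blast+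
        then have "h (Max (S i)) i \<in> P n i" by (simp add: S_def)
        then show "i \<in> {i \<in> I. x i \<in> P n i}" using i by (simp add: x_def)
      qed
    qed blast
    then show ?thesis using coset_mem_image_iff[where P = "P n", OF x sub ne] by simp
  qed
  then show ?thesis by blast
qed

section \<open>A base of neighbourhoods of the identity\<close>

definition identity_box :: "('i \<Rightarrow> 'a set) \<Rightarrow> bool" where
  "identity_box V \<longleftrightarrow> (\<forall>i\<in>I. openin (T i) (V i) \<and> \<one>\<^bsub>G i\<^esub> \<in> V i)"

lemma identity_box_subset_carrier: "\<lbrakk>identity_box V; i \<in> I\<rbrakk> \<Longrightarrow> V i \<subseteq> carrier (G i)"
  unfolding identity_box_def using openin_subset topspace_factor by blast

lemma neighbourhood_of_identity_box:
  assumes "identity_box V"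
  shows "neighbourhood_of (Bankston_topology I G T \<U>) \<one>\<^bsub>Bankston_group I G \<U>\<^esub> (\<pi> ` PiE I V)"
proof -
  have "openin (box_topology I T) (PiE I V)"
    using assms by (intro openin_box_topology_PiE) (simp add: identity_box_def)
  then have "openin (Bankston_topology I G T \<U>) (\<pi> ` PiE I V)"
    using P.open_map_coset[OF kernel_normal] unfolding open_map_def Bankston_topology_def by blast
  moreover have "\<one>\<^bsub>Bankston_group I G \<U>\<^esub> \<in> \<pi> ` PiE I V"
    unfolding one_Bankston by (rule imageI) (use assms in \<open>simp add: identity_box_def PiE_iff extensional_def\<close>)
  ultimately show ?thesis
    unfolding neighbourhood_of_def using openin_subset by blast
qed

text \<open>The preimage of an open part of \<open>W\<close> is open in the box topology and
  contains the identity of the product, hence a box around it.\<close>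

lemma identity_box_subset_neighbourhood:
  assumes "neighbourhood_of (Bankston_topology I G T \<U>) \<one>\<^bsub>Bankston_group I G \<U>\<^esub> W"
  obtains V where "identity_box V" "\<pi> ` PiE I V \<subseteq> W"
proof -
  obtain O' where O': "openin (Bankston_topology I G T \<U>) O'" "\<one>\<^bsub>Bankston_group I G \<U>\<^esub> \<in> O'" "O' \<subseteq> W"
    using assms unfolding neighbourhood_of_def by blast
  let ?S = "{x \<in> topspace (box_topology I T). \<pi> x \<in> O'}"
  have "openin (box_topology I T) ?S"
    using O'(1) unfolding Bankston_topology_def openin_quotient_topology by blast
  moreover have "\<one>\<^bsub>product_group I G\<^esub> \<in> ?S"
    using O'(2) P.one_closed unfolding P.topspace_eq_carrier one_Bankston by simp
  ultimately obtain V where V: "\<forall>i\<in>I. openin (T i) (V i)" "\<one>\<^bsub>product_group I G\<^esub> \<in> PiE I V" "PiE I V \<subseteq> ?S"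
    unfolding openin_box_topology by meson
  show thesis
  proof (rule that)
    show "identity_box V" using V unfolding identity_box_def by (auto simp: PiE_iff)
    show "\<pi> ` PiE I V \<subseteq> W" using V(3) O'(3) by blast
  qed
qed

section \<open>The topological properties of the ultraproduct\<close>

text \<open>The base consists of the images of identity boxes. Their translates are images of boxes
  of cosets, so saturation applies to any decreasing sequence of them.\<close>

lemma spherically_complete_Bankston:
  "spherically_complete (Bankston_group I G \<U>) (Bankston_topology I G T \<U>)"
  unfolding spherically_complete_def
proof (intro conjI exI allI impI B.topological_group_axioms)
  let ?B = "{\<pi> ` PiE I V | V. identity_box V}"
  show "neighbourhood_base (Bankston_topology I G T \<U>) \<one>\<^bsub>Bankston_group I G \<U>\<^esub> ?B"
    unfolding neighbourhood_base_def
  proof (intro conjI ballI allI impI)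
    fix V assume "V \<in> ?B"
    then show "neighbourhood_of (Bankston_topology I G T \<U>) \<one>\<^bsub>Bankston_group I G \<U>\<^esub> V"
      using neighbourhood_of_identity_box by blast
  next
    fix W assume "neighbourhood_of (Bankston_topology I G T \<U>) \<one>\<^bsub>Bankston_group I G \<U>\<^esub> W"
    then obtain V where "identity_box V" "\<pi> ` PiE I V \<subseteq> W" by (rule identity_box_subset_neighbourhood)
    then show "\<exists>V\<in>?B. V \<subseteq> W" by blast
  qed
  fix W g
  assume *: "(\<forall>n. W n \<in> ?B) \<and> decseq W \<and> (\<forall>n. g n \<in> carrier (Bankston_group I G \<U>)) \<and>
    decseq (\<lambda>n. g n <#\<^bsub>Bankston_group I G \<U>\<^esub> W n)"
  note W = conjunct1[OF *] and g = conjunct1[OF conjunct2[OF conjunct2[OF *]]]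
    and dec = conjunct2[OF conjunct2[OF conjunct2[OF *]]]
  from W have "\<forall>n. \<exists>V. W n = \<pi> ` PiE I V \<and> identity_box V" by simp
  from choice[OF this] obtain V where "\<forall>n. W n = \<pi> ` PiE I (V n) \<and> identity_box (V n)" ..
  then have V: "identity_box (V n)" "W n = \<pi> ` PiE I (V n)" for n by (simp_all only:)
  have "\<forall>n. \<exists>h. h \<in> (\<Pi>\<^sub>E i\<in>I. carrier (G i)) \<and> g n = \<pi> h"
  proof
    fix n
    have "g n \<in> carrier (Bankston_group I G \<U>)" using g ..
    then show "\<exists>h. h \<in> (\<Pi>\<^sub>E i\<in>I. carrier (G i)) \<and> g n = \<pi> h"
      unfolding carrier_Bankston by blast
  qed
  from choice[OF this] obtain h where "\<forall>n. h n \<in> (\<Pi>\<^sub>E i\<in>I. carrier (G i)) \<and> g n = \<pi> (h n)" ..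
  then have h: "h n \<in> (\<Pi>\<^sub>E i\<in>I. carrier (G i))" "g n = \<pi> (h n)" for n by (simp_all only:)
  have hi: "h n i \<in> carrier (G i)" if "i \<in> I" for n i using h(1)[of n] that by (auto simp: PiE_iff)
  have eq: "g n <#\<^bsub>Bankston_group I G \<U>\<^esub> W n = \<pi> ` (\<Pi>\<^sub>E i\<in>I. h n i <#\<^bsub>G i\<^esub> V n i)" for n
    unfolding V(2) h(2) by (rule l_coset_image_PiE[OF h(1) identity_box_subset_carrier[OF V(1)]])
  show "(\<Inter>n. g n <#\<^bsub>Bankston_group I G \<U>\<^esub> W n) \<noteq> {}"
    unfolding eq
  proof (rule decseq_images_INT_nonempty)
    show "h n i <#\<^bsub>G i\<^esub> V n i \<subseteq> carrier (G i)" if "i \<in> I" for n i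
      using that by (intro group.l_coset_subset_G group identity_box_subset_carrier[OF V(1)] hi)
    show "h n i <#\<^bsub>G i\<^esub> V n i \<noteq> {}" if "i \<in> I" for n i
      using V(1)[of n] that unfolding identity_box_def l_coset_def by blast
    show "decseq (\<lambda>n. \<pi> ` (\<Pi>\<^sub>E i\<in>I. h n i <#\<^bsub>G i\<^esub> V n i))"
      using dec unfolding eq .
  qed
qed

text \<open>A countable base at the identity is defeated by one point: diagonalisation yields a
  nontrivial element lying in every \<open>W n\<close>, which contradicts separation.\<close>

lemma not_metrizable_Bankston:
  assumes nondiscrete: "\<And>i. i \<in> I \<Longrightarrow> T i \<noteq> discrete_topology (carrier (G i))"
  shows "\<not> metrizable_space (Bankston_topology I G T \<U>)"
proof
  let ?X = "Bankston_topology I G T \<U>" and ?e = "\<one>\<^bsub>Bankston_group I G \<U>\<^esub>"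
  assume metr: "metrizable_space ?X"
  have e: "?e \<in> topspace ?X" using B.one_closed B.topspace_eq_carrier by simp
  obtain W :: "nat \<Rightarrow> ('i \<Rightarrow> 'a) set set" where W: "\<And>n. openin ?X (W n)" "\<And>n. ?e \<in> W n"
    "\<And>U. openin ?X U \<Longrightarrow> ?e \<in> U \<Longrightarrow> \<exists>n. W n \<subseteq> U"
    using metrizable_decseq_base[OF metr e] by metis
  have "\<exists>V. identity_box V \<and> \<pi> ` PiE I V \<subseteq> W n" for n
  proof -
    have "neighbourhood_of ?X ?e (W n)"
      unfolding neighbourhood_of_def using openin_subset[OF W(1)] W(1,2)[of n]
      by (intro conjI exI[of _ "W n"]) simp_all
    then obtain V where "identity_box V" "\<pi> ` PiE I V \<subseteq> W n"
      by (rule identity_box_subset_neighbourhood)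
    then show ?thesis by (intro exI conjI)
  qed
  then have "\<forall>n. \<exists>V. identity_box V \<and> \<pi> ` PiE I V \<subseteq> W n" by blast
  from choice[OF this] obtain V where V: "\<And>n. identity_box (V n)" "\<And>n. \<pi> ` PiE I (V n) \<subseteq> W n"
    by blast
  \<comment> \<open>In each coordinate the intersection is finite, so \<open>Z i\<close> stays open;
    yet \<open>Z i\<close> is contained in \<open>V n i\<close> for every \<open>i\<close> at
    position \<open>n\<close> or later.\<close>
  define Z where "Z i = (\<Inter>k\<le>to_nat_on I i. V k i)" for i
  have Z: "openin (T i) (Z i)" "\<one>\<^bsub>G i\<^esub> \<in> Z i" if "i \<in> I" for i
    using V(1) that unfolding Z_def identity_box_def by (auto intro!: openin_INT2)
  have "\<exists>z. z \<in> Z i \<and> z \<noteq> \<one>\<^bsub>G i\<^esub>" if i: "i \<in> I" for i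
  proof (rule ccontr)
    interpret Gi: topological_group "G i" "T i" by (rule topological_group[OF i])
    assume "\<nexists>z. z \<in> Z i \<and> z \<noteq> \<one>\<^bsub>G i\<^esub>"
    then have "Z i = {\<one>\<^bsub>G i\<^esub>}" using Z(2)[OF i] by blast
    then have one: "openin (T i) {\<one>\<^bsub>G i\<^esub>}" using Z(1)[OF i] by simp
    \<comment> \<open>An isolated identity makes every point isolated by translation, against
      non-discreteness.\<close>
    have "openin (T i) {a}" if "a \<in> carrier (G i)" for a
      using Gi.openin_l_coset[OF one that] that by (simp add: l_coset_def)
    then have "T i = discrete_topology (carrier (G i))"
      using Gi.topspace_eq_carrier by (metis discrete_topology_unique)
    then show False using nondiscrete[OF i] by simp
  qed
  then have "\<forall>i\<in>I. \<exists>z. z \<in> Z i \<and> z \<noteq> \<one>\<^bsub>G i\<^esub>" by blast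
  from bchoice[OF this] obtain z where z: "\<forall>i\<in>I. z i \<in> Z i \<and> z i \<noteq> \<one>\<^bsub>G i\<^esub>" ..
  define x where "x = restrict z I"
  have xV: "{i \<in> I. x i \<in> V n i} \<in> \<U>" for n
    by (rule ultrafilter_mono[OF ultrafilter_tail[of n]]) (use z in \<open>auto simp: x_def Z_def\<close>)
  have x: "x \<in> (\<Pi>\<^sub>E i\<in>I. carrier (G i))"
  proof -
    have "z i \<in> carrier (G i)" if "i \<in> I" for i
      using z that openin_subset[OF Z(1)[OF that]] topspace_factor[OF that] by blast
    then show ?thesis by (auto simp: x_def)
  qed
  have V_ne: "V n i \<noteq> {}" if "i \<in> I" for n i
    using V(1)[of n] that unfolding identity_box_def by blast
  have xW: "\<pi> x \<in> W n" for n
    using coset_mem_image_iff[where P = "V n", OF x identity_box_subset_carrier[OF V(1)] V_ne] xV V(2)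
    by blast
  have "\<pi> x \<noteq> ?e"
  proof
    assume "\<pi> x = ?e"
    then have "{i \<in> I. x i = (\<lambda>i\<in>I. \<one>\<^bsub>G i\<^esub>) i} \<in> \<U>"
      using coset_eq_iff[OF x, of "\<lambda>i\<in>I. \<one>\<^bsub>G i\<^esub>"] P.one_closed by (simp add: one_Bankston)
    moreover have "{i \<in> I. x i = (\<lambda>i\<in>I. \<one>\<^bsub>G i\<^esub>) i} = {}" using z by (auto simp: x_def)
    ultimately show False using ultrafilter_nonempty by metis
  qed
  \<comment> \<open>Metrizability makes points closed, so the complement of this point is a
    neighbourhood of the identity and would have to contain some \<open>W n\<close>.\<close>
  moreover have "openin ?X (topspace ?X - {\<pi> x})"
  proof (rule openin_diff[OF openin_topspace])
    have "\<pi> x \<in> topspace ?X" using xW[of 0] openin_subset[OF W(1)] by blast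
    then show "closedin ?X {\<pi> x}" by (rule closedin_t1_singleton[OF metrizable_imp_t1_space[OF metr]])
  qed
  ultimately obtain n where "W n \<subseteq> topspace ?X - {\<pi> x}"
    using W(3)[of "topspace ?X - {\<pi> x}"] e by auto
  then show False using xW[of n] by blast
qed

text \<open>A basic box amounts to choosing in each factor a member of a decreasing countable base,
  that is, to a function from \<open>I\<close> to nat. Enumerating \<open>I\<close> turns it into a
  function on nat, and larger functions give smaller boxes.\<close>

lemma has_local_omega_omega_base_Bankston:
  assumes metr: "\<And>i. i \<in> I \<Longrightarrow> metrizable_space (T i)"
  shows "has_local_omega_omega_base (Bankston_group I G \<U>) (Bankston_topology I G T \<U>)"
proof -
  have "\<exists>W :: nat \<Rightarrow> 'a set. (\<forall>n. openin (T i) (W n) \<and> \<one>\<^bsub>G i\<^esub> \<in> W n) \<and> decseq W \<and>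
      (\<forall>U. openin (T i) U \<and> \<one>\<^bsub>G i\<^esub> \<in> U \<longrightarrow> (\<exists>n. W n \<subseteq> U))" if i: "i \<in> I" for i
  proof -
    have "\<one>\<^bsub>G i\<^esub> \<in> topspace (T i)"
      using group[OF i] topspace_factor[OF i] by (simp add: group.is_monoid)
    then show ?thesis using metrizable_decseq_base[OF metr[OF i]] by metis
  qed
  from bchoice[OF ballI[OF this]] obtain W :: "'i \<Rightarrow> nat \<Rightarrow> 'a set" where
    W: "\<forall>i\<in>I. (\<forall>n. openin (T i) (W i n) \<and> \<one>\<^bsub>G i\<^esub> \<in> W i n) \<and> decseq (W i) \<and>
      (\<forall>U. openin (T i) U \<and> \<one>\<^bsub>G i\<^esub> \<in> U \<longrightarrow> (\<exists>n. W i n \<subseteq> U))" ..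
  let ?U = "\<lambda>\<alpha>. \<pi> ` (\<Pi>\<^sub>E i\<in>I. W i (\<alpha> (to_nat_on I i)))"
  show ?thesis
    unfolding has_local_omega_omega_base_def
  proof (intro conjI exI[of _ ?U] allI impI B.topological_group_axioms)
    show "neighbourhood_of (Bankston_topology I G T \<U>) \<one>\<^bsub>Bankston_group I G \<U>\<^esub> (?U \<alpha>)" for \<alpha>
      by (rule neighbourhood_of_identity_box) (use W in \<open>simp add: identity_box_def\<close>)
    show "?U \<beta> \<subseteq> ?U \<alpha>" if "\<alpha> \<le> \<beta>" for \<alpha> \<beta>
      using that W by (intro image_mono PiE_mono) (auto simp: le_fun_def dest: decseqD)
    fix S assume "neighbourhood_of (Bankston_topology I G T \<U>) \<one>\<^bsub>Bankston_group I G \<U>\<^esub> S"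
    then obtain V where V: "identity_box V" "\<pi> ` PiE I V \<subseteq> S" by (rule identity_box_subset_neighbourhood)
    have "\<forall>i\<in>I. \<exists>n. W i n \<subseteq> V i" using W V(1) unfolding identity_box_def by blast
    from bchoice[OF this] obtain a where a: "\<forall>i\<in>I. W i (a i) \<subseteq> V i" ..
    \<comment> \<open>On \<open>I\<close> the map \<open>from_nat_into I\<close> inverts
      \<open>to_nat_on I\<close>, so \<open>\<alpha>\<close> takes the value \<open>a i\<close> at
      the position of \<open>i\<close>.\<close>
    define \<alpha> where "\<alpha> n = a (from_nat_into I n)" for n
    have "W i (\<alpha> (to_nat_on I i)) \<subseteq> V i" if "i \<in> I" for i
      using a that countable_index by (simp add: \<alpha>_def)
    then have "?U \<alpha> \<subseteq> \<pi> ` PiE I V" by (intro image_mono PiE_mono)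
    then show "\<exists>\<alpha>. ?U \<alpha> \<subseteq> S" using V(2) by blast
  qed
qed

end

theorem theorem2p13:
  fixes I :: "'i set"
    and G :: "'i \<Rightarrow> ('a, 'b) monoid_scheme"
    and T :: "'i \<Rightarrow> 'a topology"
    and \<U> :: "'i set set"
  assumes "countable I"
    and "\<And>i. i \<in> I \<Longrightarrow> topological_group (G i) (T i)"
    and "\<And>i. i \<in> I \<Longrightarrow> metrizable_space (T i)"
    and "ultrafilter_on I \<U>"
    and "\<not> principal_ultrafilter_on I \<U>"
  shows "spherically_complete (Bankston_group I G \<U>) (Bankston_topology I G T \<U>) \<and>
    ((\<forall>i\<in>I. T i \<noteq> discrete_topology (carrier (G i))) \<longrightarrow>
       \<not> metrizable_space (Bankston_topology I G T \<U>) \<and>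
       Baire_space (Bankston_topology I G T \<U>) \<and>
       has_local_omega_omega_base (Bankston_group I G \<U>) (Bankston_topology I G T \<U>))"
proof -
  interpret countable_ultraproduct I G T \<U>
    by (rule countable_ultraproduct.intro) (fact assms)+
  show ?thesis
    using spherically_complete_Bankston spherically_complete_imp_Baire_space[OF spherically_complete_Bankston]
      not_metrizable_Bankston has_local_omega_omega_base_Bankston[OF assms(3)] by blast
qed

end
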